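(* Let $g$ be a smooth vector field on $\mathbb{R}^n$ and $\omega$ a smooth 1-form on $\mathbb{R}^n$ with $\omega(g)\neq0$ everywhere and $d\omega\wedge\omega=0$. Let $\mathcal{O}=\{x\in\mathbb{R}^n:\psi(x)=0\}$ be an integral manifold of $\omega$, where $\psi:\mathbb{R}^n\to\mathbb{R}$ is smooth with $d\psi=\mu\,\omega$ for a nowhere vanishing function $\mu$, and let $\pi:\mathbb{R}^n\to\mathcal{O}$ be the smooth projection along integral curves of $g$. Then for all classes $\bar m_1,\bar m_2$ of smooth vector fields modulo multiples of $g$ and all $\alpha\in C^\infty(\mathcal{O})$, $$\langle\bar m_1,\alpha\bar m_2\rangle=\alpha\langle\bar m_1,\bar m_2\rangle+\big(\mathrm{an}_\pi(\bar m_1)(\alpha)\big)\,\bar m_2 .$$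
   Context: Standing assumption: every maximal integral curve of $g$ meets $\mathcal{O}$ in exactly one point; $\pi(x)$ is the point where the integral curve of $g$ through $x$ meets $\mathcal{O}$, so $d\pi(g)=0$. $\bar m$ denotes the class of a smooth vector field $m$ on $\mathbb{R}^n$ modulo $\{\beta g:\beta\in C^\infty(\mathbb{R}^n)\}$. The bracket $\langle\bar m_1,\bar m_2\rangle$ is the class of $$\langle m_1,m_2\rangle=[m_1,m_2]+\frac{\omega(m_2)}{\omega(g)}[g,m_1]-\frac{\omega(m_1)}{\omega(g)}[g,m_2],$$ which is independent of the representatives; $[\cdot,\cdot]$ is the usual Lie bracket. A function $\alpha\in C^\infty(\mathcal{O})$ is regarded as a function on $\mathbb{R}^n$ constant along integral curves of $g$, namely $\alpha\circ\pi$. The anchor is $\mathrm{an}_\pi(\bar m):=\pi_*m$, i.e. $x\mapsto d\pi_x(m(x))\in T_{\pi(x)}\mathcal{O}$ (independent of the representative $m$), and $\mathrm{an}_\pi(\bar m)(\alpha)$ is the function $x\mapsto d\alpha_{\pi(x)}\big(d\pi_x(m(x))\big)$. *)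

theory Defs
  imports "HOL-Analysis.Analysis"
begin

text \<open>
  Smoothness is only meant for open sets \<open>S\<close>. The recursion runs through directional derivatives
  so that the codomain stays the same type; as the domain is finite-dimensional, this is the usual
  notion of \<open>C\<^sup>k\<close>.
\<close>

primrec Ck_on :: "nat \<Rightarrow> 'a::euclidean_space set \<Rightarrow> ('a \<Rightarrow> 'b::real_normed_vector) \<Rightarrow> bool" where
  "Ck_on 0 S f \<longleftrightarrow> continuous_on S f"
| "Ck_on (Suc k) S f \<longleftrightarrow>
     (\<forall>x\<in>S. f differentiable (at x)) \<and> (\<forall>v. Ck_on k S (\<lambda>x. frechet_derivative f (at x) v))"

definition smooth_on :: "'a::euclidean_space set \<Rightarrow> ('a \<Rightarrow> 'b::real_normed_vector) \<Rightarrow> bool" where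
  "smooth_on S f \<longleftrightarrow> (\<forall>k. Ck_on k S f)"

text \<open>
  Smooth functions on an embedded submanifold \<open>N\<close>: those which locally extend to smooth functions
  on the ambient space. Only the values of \<open>\<alpha>\<close> on \<open>N\<close> matter.
\<close>

definition smooth_fun_on_submanifold ::
    "'a::euclidean_space set \<Rightarrow> ('a \<Rightarrow> 'b::real_normed_vector) \<Rightarrow> bool" where
  "smooth_fun_on_submanifold N \<alpha> \<longleftrightarrow>
     (\<forall>p\<in>N. \<exists>U F. open U \<and> p \<in> U \<and> smooth_on U F \<and> (\<forall>x\<in>U \<inter> N. F x = \<alpha> x))"

text \<open>
  A 1-form is a map into the dual space. The wedge of a 2-form and a 1-form is the sum over the
  (2,1)-shuffles.
\<close>

type_synonym 'n one_form = "real^'n \<Rightarrow> (real^'n) \<Rightarrow>\<^sub>L real"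

definition ext_deriv :: "'n::finite one_form \<Rightarrow> real^'n \<Rightarrow> real^'n \<Rightarrow> real^'n \<Rightarrow> real" where
  "ext_deriv \<omega> x u v =
     blinfun_apply (frechet_derivative \<omega> (at x) u) v - blinfun_apply (frechet_derivative \<omega> (at x) v) u"

definition wedge_2_1 ::
    "(real^'n::finite \<Rightarrow> real^'n \<Rightarrow> real) \<Rightarrow> (real^'n) \<Rightarrow>\<^sub>L real \<Rightarrow> real^'n \<Rightarrow> real^'n \<Rightarrow> real^'n \<Rightarrow> real" where
  "wedge_2_1 \<eta> \<theta> u v w =
     \<eta> u v * blinfun_apply \<theta> w - \<eta> u w * blinfun_apply \<theta> v + \<eta> v w * blinfun_apply \<theta> u"

definition integral_curve :: "(real^'n::finite \<Rightarrow> real^'n) \<Rightarrow> real set \<Rightarrow> (real \<Rightarrow> real^'n) \<Rightarrow> bool" where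
  "integral_curve g J \<gamma> \<longleftrightarrow>
     open J \<and> is_interval J \<and> J \<noteq> {} \<and> (\<forall>t\<in>J. (\<gamma> has_vector_derivative g (\<gamma> t)) (at t))"

definition maximal_integral_curve ::
    "(real^'n::finite \<Rightarrow> real^'n) \<Rightarrow> real set \<Rightarrow> (real \<Rightarrow> real^'n) \<Rightarrow> bool" where
  "maximal_integral_curve g J \<gamma> \<longleftrightarrow>
     integral_curve g J \<gamma> \<and>
     (\<forall>J' \<gamma>'. integral_curve g J' \<gamma>' \<and> J \<subseteq> J' \<and> (\<forall>t\<in>J. \<gamma>' t = \<gamma> t) \<longrightarrow> J' = J)"

text \<open>
  The map \<open>\<pi>\<close> sends \<open>x\<close> to a point at which the maximal integral curve of \<open>g\<close> through \<open>x\<close>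
  meets \<open>N\<close>. For smooth \<open>g\<close> that curve exists and is unique up to a shift of the parameter.
\<close>

definition projection_along ::
    "(real^'n::finite \<Rightarrow> real^'n) \<Rightarrow> (real^'n) set \<Rightarrow> (real^'n \<Rightarrow> real^'n) \<Rightarrow> bool" where
  "projection_along g N \<pi> \<longleftrightarrow>
     (\<forall>x. \<exists>J \<gamma>. maximal_integral_curve g J \<gamma> \<and> x \<in> \<gamma> ` J \<and> \<pi> x \<in> \<gamma> ` J \<inter> N)"

definition lie_bracket ::
    "(real^'n::finite \<Rightarrow> real^'n) \<Rightarrow> (real^'n \<Rightarrow> real^'n) \<Rightarrow> real^'n \<Rightarrow> real^'n" where
  "lie_bracket X Y x = frechet_derivative Y (at x) (X x) - frechet_derivative X (at x) (Y x)"

definition modified_bracket ::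
    "(real^'n::finite \<Rightarrow> real^'n) \<Rightarrow> 'n one_form \<Rightarrow>
     (real^'n \<Rightarrow> real^'n) \<Rightarrow> (real^'n \<Rightarrow> real^'n) \<Rightarrow> real^'n \<Rightarrow> real^'n" where
  "modified_bracket g \<omega> m\<^sub>1 m\<^sub>2 x =
     lie_bracket m\<^sub>1 m\<^sub>2 x
     + (blinfun_apply (\<omega> x) (m\<^sub>2 x) / blinfun_apply (\<omega> x) (g x)) *\<^sub>R lie_bracket g m\<^sub>1 x
     - (blinfun_apply (\<omega> x) (m\<^sub>1 x) / blinfun_apply (\<omega> x) (g x)) *\<^sub>R lie_bracket g m\<^sub>2 x"

definition vector_fields :: "(real^'n::finite \<Rightarrow> real^'n) set" where
  "vector_fields = {m. smooth_on UNIV m}"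

definition cong_mod ::
    "(real^'n::finite \<Rightarrow> real^'n) \<Rightarrow> ((real^'n \<Rightarrow> real^'n) \<times> (real^'n \<Rightarrow> real^'n)) set" where
  "cong_mod g =
     {(m, m'). m \<in> vector_fields \<and> m' \<in> vector_fields \<and>
        (\<exists>\<beta>::real^'n \<Rightarrow> real. smooth_on UNIV \<beta> \<and> (\<forall>x. m' x = m x + \<beta> x *\<^sub>R g x))}"

definition field_class ::
    "(real^'n::finite \<Rightarrow> real^'n) \<Rightarrow> (real^'n \<Rightarrow> real^'n) \<Rightarrow> (real^'n \<Rightarrow> real^'n) set" where
  "field_class g m = cong_mod g `` {m}"

text \<open>
  Operations on classes are unions of the classes obtained from all representatives. As the
  operations do not depend on the representatives, each such union is a single class.
\<close>

definition class_add ::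
    "(real^'n::finite \<Rightarrow> real^'n) \<Rightarrow> (real^'n \<Rightarrow> real^'n) set \<Rightarrow> (real^'n \<Rightarrow> real^'n) set \<Rightarrow>
     (real^'n \<Rightarrow> real^'n) set" where
  "class_add g M\<^sub>1 M\<^sub>2 = (\<Union>m\<^sub>1\<in>M\<^sub>1. \<Union>m\<^sub>2\<in>M\<^sub>2. field_class g (\<lambda>x. m\<^sub>1 x + m\<^sub>2 x))"

definition class_scale ::
    "(real^'n::finite \<Rightarrow> real^'n) \<Rightarrow> (real^'n \<Rightarrow> real) \<Rightarrow> (real^'n \<Rightarrow> real^'n) set \<Rightarrow>
     (real^'n \<Rightarrow> real^'n) set" where
  "class_scale g f M = (\<Union>m\<in>M. field_class g (\<lambda>x. f x *\<^sub>R m x))"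

definition class_bracket ::
    "(real^'n::finite \<Rightarrow> real^'n) \<Rightarrow> 'n one_form \<Rightarrow>
     (real^'n \<Rightarrow> real^'n) set \<Rightarrow> (real^'n \<Rightarrow> real^'n) set \<Rightarrow> (real^'n \<Rightarrow> real^'n) set" where
  "class_bracket g \<omega> M\<^sub>1 M\<^sub>2 =
     (\<Union>m\<^sub>1\<in>M\<^sub>1. \<Union>m\<^sub>2\<in>M\<^sub>2. field_class g (modified_bracket g \<omega> m\<^sub>1 m\<^sub>2))"

text \<open>
  The value at \<open>x\<close> of the push-forward of any representative of the class; by \<open>d\<pi>(g) = 0\<close> the
  image below is a singleton.
\<close>

definition anchor ::
    "(real^'n::finite \<Rightarrow> real^'n) \<Rightarrow> (real^'n \<Rightarrow> real^'n) set \<Rightarrow> real^'n \<Rightarrow> real^'n" where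
  "anchor \<pi> M x = the_elem ((\<lambda>m. frechet_derivative \<pi> (at x) (m x)) ` M)"

text \<open>
  The differential of \<open>\<alpha>\<close> at \<open>\<pi> x\<close> is taken within the submanifold \<open>N\<close>. Derivatives within \<open>N\<close> are
  unique only on the tangent space of \<open>N\<close>, and \<open>anchor \<pi> M x\<close> lies in it.
\<close>

definition anchor_deriv ::
    "(real^'n::finite) set \<Rightarrow> (real^'n \<Rightarrow> real^'n) \<Rightarrow> (real^'n \<Rightarrow> real^'n) set \<Rightarrow> (real^'n \<Rightarrow> real) \<Rightarrow>
     real^'n \<Rightarrow> real" where
  "anchor_deriv N \<pi> M \<alpha> x = frechet_derivative \<alpha> (at (\<pi> x) within N) (anchor \<pi> M x)"

end

theory Submission
  imports Defs
begin

text \<open>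
  The identity is the Leibniz rule of the Lie bracket, once \<open>f = \<alpha> \<circ> \<pi>\<close> is known to satisfy
  \<open>df(g) = 0\<close>: then \<open>[g, f m\<^sub>2] = f [g, m\<^sub>2]\<close>, and the only extra term is \<open>df(m\<^sub>1) m\<^sub>2\<close>, which is the
  anchor term by the chain rule. Two integral curves of \<open>g\<close> through the same point agree, so \<open>\<pi>\<close> is
  constant on each maximal one, whence \<open>d\<pi>(g) = 0\<close>. Changing representatives changes the modified
  bracket by a smooth multiple of \<open>g\<close>, since the correction terms cancel \<open>\<beta> [g, m\<^sub>2]\<close> and
  \<open>\<gamma> [m\<^sub>1, g]\<close> in \<open>[m\<^sub>1 + \<beta> g, m\<^sub>2 + \<gamma> g]\<close>.
\<close>

section \<open>Calculus of smooth maps\<close>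

text \<open>On an open set, equal values force equal derivatives at each point, so the recursion of
  \<open>Ck_on\<close> sees no difference.\<close>

lemma Ck_on_cong:
  assumes "open S" "\<And>x. x \<in> S \<Longrightarrow> f x = g x"
  shows "Ck_on k S f \<longleftrightarrow> Ck_on k S g"
  using assms(2)
proof (induction k arbitrary: f g)
  case 0
  then show ?case by (auto cong: continuous_on_cong)
next
  case (Suc k)
  have der: "(f has_derivative D) (at x) \<longleftrightarrow> (g has_derivative D) (at x)" if "x \<in> S" for x D
    by (auto intro: has_derivative_transform_within_open[OF _ assms(1) that] simp: Suc.prems)
  have diff: "f differentiable (at x) \<longleftrightarrow> g differentiable (at x)"
    and fd: "frechet_derivative f (at x) = frechet_derivative g (at x)" if "x \<in> S" for x
    using der[OF that] by (simp_all add: differentiable_def frechet_derivative_def)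
  have "Ck_on k S (\<lambda>x. frechet_derivative f (at x) v)
      \<longleftrightarrow> Ck_on k S (\<lambda>x. frechet_derivative g (at x) v)" for v
    by (rule Suc.IH) (simp add: fd)
  then show ?case using diff by simp
qed

text \<open>Lets an explicit formula \<open>f'\<close> stand in for the chosen
  \<open>frechet_derivative\<close>; uniqueness of the derivative identifies the two on
  \<open>S\<close>.\<close>

lemma Ck_on_SucI:
  assumes "open S" "\<And>x. x \<in> S \<Longrightarrow> (f has_derivative f' x) (at x)"
    and "\<And>v. Ck_on k S (\<lambda>x. f' x v)"
  shows "Ck_on (Suc k) S f"
proof -
  have "Ck_on k S (\<lambda>x. frechet_derivative f (at x) v)" for v
    using assms(3)[of v] Ck_on_cong[OF assms(1), of "\<lambda>x. f' x v"]
      frechet_derivative_at[OF assms(2)] by fastforce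
  then show ?thesis using assms(2) by (auto simp: differentiable_def)
qed

lemma Ck_on_Suc_has_derivative:
  assumes "Ck_on (Suc k) S f" "x \<in> S"
  shows "(f has_derivative frechet_derivative f (at x)) (at x)"
  using assms frechet_derivative_works by auto

lemma Ck_on_Suc_frechet_derivative:
  assumes "Ck_on (Suc k) S f"
  shows "Ck_on k S (\<lambda>x. frechet_derivative f (at x) v)"
  using assms by simp

lemma Ck_on_SucD: "Ck_on (Suc k) S f \<Longrightarrow> Ck_on k S f"
proof (induction k arbitrary: f)
  case 0
  then show ?case
    by (auto intro!: continuous_at_imp_continuous_on differentiable_imp_continuous_within)
next
  case (Suc k)
  have "Ck_on k S (\<lambda>x. frechet_derivative f (at x) v)" for v
    by (rule Suc.IH) (rule Ck_on_Suc_frechet_derivative[OF Suc.prems])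
  then show ?case using Suc.prems by simp
qed

lemma Ck_on_subset: "Ck_on k S f \<Longrightarrow> T \<subseteq> S \<Longrightarrow> Ck_on k T f"
  by (induction k arbitrary: f) (auto intro: continuous_on_subset)

text \<open>The recursion only asks for differentiability and continuity at single points. This
  allows smoothness to be checked with a different local extension near each point.\<close>

lemma Ck_on_local:
  assumes "\<And>x. x \<in> S \<Longrightarrow> \<exists>U. open U \<and> x \<in> U \<and> Ck_on k U f"
  shows "Ck_on k S f"
  using assms
proof (induction k arbitrary: f)
  case 0
  have "continuous (at x) f" if "x \<in> S" for x
    using 0[OF that] by (auto simp: continuous_on_eq_continuous_at)
  then show ?case by (simp add: continuous_at_imp_continuous_on)
next
  case (Suc k)
  have "Ck_on k S (\<lambda>x. frechet_derivative f (at x) v)" for v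
    by (rule Suc.IH) (use Suc.prems in fastforce)
  moreover have "f differentiable (at x)" if "x \<in> S" for x
    using Suc.prems[OF that] by auto
  ultimately show ?case by simp
qed

lemma Ck_on_const: "open S \<Longrightarrow> Ck_on k S (\<lambda>x. c)"
proof (induction k arbitrary: c)
  case (Suc k)
  show ?case
    by (rule Ck_on_SucI[OF Suc.prems has_derivative_const]) (rule Suc.IH[OF Suc.prems])
qed simp

lemma Ck_on_add:
  assumes "open S"
  shows "Ck_on k S f \<Longrightarrow> Ck_on k S g \<Longrightarrow> Ck_on k S (\<lambda>x. f x + g x)"
proof (induction k arbitrary: f g)
  case (Suc k)
  show ?case
  proof (rule Ck_on_SucI[OF assms])
    show "((\<lambda>x. f x + g x) has_derivative
        (\<lambda>v. frechet_derivative f (at x) v + frechet_derivative g (at x) v)) (at x)" if "x \<in> S" for x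
      by (rule has_derivative_add[OF Suc.prems[THEN Ck_on_Suc_has_derivative, OF that]])
    show "Ck_on k S (\<lambda>x. frechet_derivative f (at x) v + frechet_derivative g (at x) v)" for v
      by (intro Suc.IH Suc.prems[THEN Ck_on_Suc_frechet_derivative])
  qed
qed (auto intro: continuous_on_add)

text \<open>The product rule gives a sum of two products, each pairing one function with a
  derivative of the other. All factors are of class \<open>k\<close>, so the induction hypothesis,
  stated for arbitrary \<open>f\<close> and \<open>g\<close>, applies.\<close>

lemma (in bounded_bilinear) Ck_on:
  assumes "open S"
  shows "Ck_on k S f \<Longrightarrow> Ck_on k S g \<Longrightarrow> Ck_on k S (\<lambda>x. prod (f x) (g x))"
proof (induction k arbitrary: f g)
  case (Suc k)
  show ?case
  proof (rule Ck_on_SucI[OF assms])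
    show "((\<lambda>x. prod (f x) (g x)) has_derivative
        (\<lambda>v. prod (f x) (frechet_derivative g (at x) v) + prod (frechet_derivative f (at x) v) (g x)))
        (at x)" if "x \<in> S" for x
      by (rule FDERIV[OF Suc.prems[THEN Ck_on_Suc_has_derivative, OF that]])
    show "Ck_on k S (\<lambda>x. prod (f x) (frechet_derivative g (at x) v)
        + prod (frechet_derivative f (at x) v) (g x))" for v
      by (intro Ck_on_add assms Suc.IH Suc.prems[THEN Ck_on_Suc_frechet_derivative]
          Suc.prems[THEN Ck_on_SucD])
  qed
qed (simp add: continuous_on)

lemma Ck_on_sum:
  assumes "open S" "\<And>i. i \<in> I \<Longrightarrow> Ck_on k S (f i)"
  shows "Ck_on k S (\<lambda>x. \<Sum>i\<in>I. f i x)"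
  using assms(2)
  by (induction I rule: infinite_finite_induct) (auto intro: Ck_on_const Ck_on_add assms(1))

text \<open>The derivative of the reciprocal contains the reciprocal itself, but only to one order
  less, which the induction hypothesis supplies.\<close>

lemma Ck_on_inverse:
  fixes f :: "'a::euclidean_space \<Rightarrow> real"
  assumes "open S" "\<And>x. x \<in> S \<Longrightarrow> f x \<noteq> 0"
  shows "Ck_on k S f \<Longrightarrow> Ck_on k S (\<lambda>x. inverse (f x))"
proof (induction k)
  case 0
  then show ?case using assms by (auto intro: continuous_on_inverse)
next
  case (Suc k)
  note inv = Suc.IH[OF Ck_on_SucD[OF Suc.prems]]
  show ?case
  proof (rule Ck_on_SucI[OF assms(1)])
    show "((\<lambda>x. inverse (f x)) has_derivative
        (\<lambda>v. - (inverse (f x) * frechet_derivative f (at x) v * inverse (f x)))) (at x)"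
      if "x \<in> S" for x
      by (rule Deriv.has_derivative_inverse[OF assms(2)[OF that] Ck_on_Suc_has_derivative[OF Suc.prems that]])
    \<comment> \<open>The sign is written as a constant factor so that the bilinear rule covers
      it.\<close>
    have "Ck_on k S (\<lambda>x. (-1) * (inverse (f x) * frechet_derivative f (at x) v * inverse (f x)))" for v
      by (intro bounded_bilinear.Ck_on[OF bounded_bilinear_mult] assms(1) inv Ck_on_const
          Ck_on_Suc_frechet_derivative[OF Suc.prems])
    then show "Ck_on k S (\<lambda>x. - (inverse (f x) * frechet_derivative f (at x) v * inverse (f x)))" for v
      by simp
  qed
qed

text \<open>\<open>Ck_on\<close> speaks only of derivatives in a fixed direction. This expansion
  reduces a direction that varies with the point to finitely many fixed ones.\<close>

lemma linear_basis_expansion: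
  fixes D :: "'a::euclidean_space \<Rightarrow> 'b::real_vector"
  assumes "linear D"
  shows "D v = (\<Sum>b\<in>Basis. (v \<bullet> b) *\<^sub>R D b)"
proof -
  have "D v = D (\<Sum>b\<in>Basis. (v \<bullet> b) *\<^sub>R b)" by (simp add: euclidean_representation)
  also have "\<dots> = (\<Sum>b\<in>Basis. (v \<bullet> b) *\<^sub>R D b)"
    by (simp add: linear_sum[OF assms] linear_cmul[OF assms])
  finally show ?thesis .
qed

text \<open>In the chain rule the derivative of \<open>g\<close> is applied to a direction depending
  on \<open>x\<close>. Expanded in the basis, it becomes a sum of scalar coefficients times
  compositions of \<open>f\<close> with fixed directional derivatives of \<open>g\<close>, to which
  the induction hypothesis applies.\<close>

lemma Ck_on_compose:
  fixes f :: "'a::euclidean_space \<Rightarrow> 'b::euclidean_space"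
  assumes "open S" "open T" "f ` S \<subseteq> T"
  shows "Ck_on k T g \<Longrightarrow> Ck_on k S f \<Longrightarrow> Ck_on k S (\<lambda>x. g (f x))"
proof (induction k arbitrary: g)
  case 0
  then show ?case using assms(3) by (auto intro: continuous_on_compose2)
next
  case (Suc k)
  let ?Df = "\<lambda>x. frechet_derivative f (at x)" and ?Dg = "\<lambda>y. frechet_derivative g (at y)"
  have dg: "(g has_derivative ?Dg (f x)) (at (f x))" if "x \<in> S" for x
    using Ck_on_Suc_has_derivative[OF Suc.prems(1)] assms(3) that by blast
  show ?case
  proof (rule Ck_on_SucI[OF assms(1)])
    fix x assume x: "x \<in> S"
    have "((\<lambda>x. g (f x)) has_derivative (\<lambda>v. ?Dg (f x) (?Df x v))) (at x)"
      by (rule has_derivative_compose[OF Ck_on_Suc_has_derivative[OF Suc.prems(2) x] dg[OF x]])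
    moreover have "(\<lambda>v. ?Dg (f x) (?Df x v)) = (\<lambda>v. \<Sum>b\<in>Basis. (?Df x v \<bullet> b) *\<^sub>R ?Dg (f x) b)"
      by (intro ext linear_basis_expansion has_derivative_linear[OF dg[OF x]])
    ultimately show "((\<lambda>x. g (f x)) has_derivative
        (\<lambda>v. \<Sum>b\<in>Basis. (?Df x v \<bullet> b) *\<^sub>R ?Dg (f x) b)) (at x)" by (simp only:)
  next
    show "Ck_on k S (\<lambda>x. \<Sum>b\<in>Basis. (?Df x v \<bullet> b) *\<^sub>R ?Dg (f x) b)" for v
      by (intro Ck_on_sum assms(1) bounded_bilinear.Ck_on[OF bounded_bilinear_scaleR]
          bounded_bilinear.Ck_on[OF bounded_bilinear_inner] Ck_on_const Suc.IH
          Suc.prems[THEN Ck_on_Suc_frechet_derivative] Suc.prems(2)[THEN Ck_on_SucD])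
  qed
qed

section \<open>Closure properties of smooth maps\<close>

lemma smooth_on_has_derivative:
  "smooth_on S f \<Longrightarrow> x \<in> S \<Longrightarrow> (f has_derivative frechet_derivative f (at x)) (at x)"
  unfolding smooth_on_def by (rule Ck_on_Suc_has_derivative[of 0]) auto

lemma smooth_on_continuous_on: "smooth_on S f \<Longrightarrow> continuous_on S f"
  unfolding smooth_on_def by (drule spec[of _ 0]) simp

lemma smooth_on_frechet_derivative:
  assumes "smooth_on S f"
  shows "smooth_on S (\<lambda>x. frechet_derivative f (at x) v)"
  using assms unfolding smooth_on_def by (intro allI Ck_on_Suc_frechet_derivative) (rule spec)

lemma smooth_on_const: "open S \<Longrightarrow> smooth_on S (\<lambda>x. c)"
  by (simp add: smooth_on_def Ck_on_const)

lemma smooth_on_add: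
  "open S \<Longrightarrow> smooth_on S f \<Longrightarrow> smooth_on S g \<Longrightarrow> smooth_on S (\<lambda>x. f x + g x)"
  by (simp add: smooth_on_def Ck_on_add)

lemma smooth_on_sum:
  "open S \<Longrightarrow> (\<And>i. i \<in> I \<Longrightarrow> smooth_on S (f i)) \<Longrightarrow> smooth_on S (\<lambda>x. \<Sum>i\<in>I. f i x)"
  by (simp add: smooth_on_def Ck_on_sum)

lemma (in bounded_bilinear) smooth_on:
  "open S \<Longrightarrow> smooth_on S f \<Longrightarrow> smooth_on S g \<Longrightarrow> smooth_on S (\<lambda>x. prod (f x) (g x))"
  by (simp add: smooth_on_def Ck_on)

lemmas smooth_on_scaleR = bounded_bilinear.smooth_on[OF bounded_bilinear_scaleR]
lemmas smooth_on_mult = bounded_bilinear.smooth_on[OF bounded_bilinear_mult]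
lemmas smooth_on_inner = bounded_bilinear.smooth_on[OF bounded_bilinear_inner]
lemmas smooth_on_blinfun_apply = bounded_bilinear.smooth_on[OF bounded_bilinear_blinfun_apply]

lemma smooth_on_minus:
  assumes "open S" "smooth_on S f"
  shows "smooth_on S (\<lambda>x. - f x)"
  using smooth_on_scaleR[OF assms(1) smooth_on_const[OF assms(1), of "-1"] assms(2)] by simp

lemma smooth_on_diff:
  assumes "open S" "smooth_on S f" "smooth_on S g"
  shows "smooth_on S (\<lambda>x. f x - g x)"
  using smooth_on_add[OF assms(1,2) smooth_on_minus[OF assms(1,3)]] by simp

lemma smooth_on_divide:
  fixes f h :: "'a::euclidean_space \<Rightarrow> real"
  assumes "open S" "smooth_on S f" "smooth_on S h" "\<And>x. x \<in> S \<Longrightarrow> h x \<noteq> 0"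
  shows "smooth_on S (\<lambda>x. f x / h x)"
proof -
  have "smooth_on S (\<lambda>x. inverse (h x))"
    using assms by (simp add: smooth_on_def Ck_on_inverse)
  then show ?thesis
    using smooth_on_mult[OF assms(1,2)] by (simp add: divide_inverse)
qed

text \<open>The basis expansion again, now with the components of the vector field \<open>X\<close>
  as coefficients.\<close>

lemma smooth_on_frechet_derivative_apply:
  assumes "open S" "smooth_on S f" "smooth_on S X"
  shows "smooth_on S (\<lambda>x. frechet_derivative f (at x) (X x))"
proof -
  have "Ck_on k S (\<lambda>x. frechet_derivative f (at x) (X x)) \<longleftrightarrow>
      Ck_on k S (\<lambda>x. \<Sum>b\<in>Basis. (X x \<bullet> b) *\<^sub>R frechet_derivative f (at x) b)" for k
    by (intro Ck_on_cong assms(1) linear_basis_expansion)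
      (rule has_derivative_linear[OF smooth_on_has_derivative[OF assms(2)]])
  moreover have "smooth_on S (\<lambda>x. \<Sum>b\<in>Basis. (X x \<bullet> b) *\<^sub>R frechet_derivative f (at x) b)"
    by (intro smooth_on_sum smooth_on_scaleR smooth_on_inner smooth_on_const assms(1,3)
        smooth_on_frechet_derivative assms(2))
  ultimately show ?thesis unfolding smooth_on_def by blast
qed

text \<open>Near \<open>x\<close> the composition equals \<open>F \<circ> \<pi>\<close> for a local
  extension \<open>F\<close> of \<open>\<alpha>\<close>: the preimage of \<open>U\<close> is open,
  and \<open>\<pi>\<close> takes values in \<open>N\<close>, where \<open>F\<close> and
  \<open>\<alpha>\<close> agree.\<close>

lemma smooth_on_submanifold_compose:
  fixes \<pi> :: "'a::euclidean_space \<Rightarrow> 'b::euclidean_space"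
  assumes "smooth_fun_on_submanifold N \<alpha>" "smooth_on UNIV \<pi>" "range \<pi> \<subseteq> N"
  shows "smooth_on UNIV (\<alpha> \<circ> \<pi>)"
  unfolding smooth_on_def
proof (intro allI Ck_on_local)
  fix k x
  obtain U F where U: "open U" "\<pi> x \<in> U" "smooth_on U F" "\<And>y. y \<in> U \<inter> N \<Longrightarrow> F y = \<alpha> y"
    using bspec[OF assms(1)[unfolded smooth_fun_on_submanifold_def] subsetD[OF assms(3) rangeI[of \<pi> x]]]
    by auto
  have op: "open (\<pi> -` U)" by (rule open_vimage[OF U(1) smooth_on_continuous_on[OF assms(2)]])
  have "Ck_on k (\<pi> -` U) (\<lambda>y. F (\<pi> y))"
  proof (rule Ck_on_compose[OF op U(1), where f = \<pi> and g = F])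
    show "Ck_on k U F" using U(3) by (simp add: smooth_on_def)
    show "Ck_on k (\<pi> -` U) \<pi>"
      by (rule Ck_on_subset[of k UNIV \<pi>]) (use assms(2) in \<open>auto simp: smooth_on_def\<close>)
  qed auto
  moreover have "Ck_on k (\<pi> -` U) (\<lambda>y. F (\<pi> y)) \<longleftrightarrow> Ck_on k (\<pi> -` U) (\<alpha> \<circ> \<pi>)"
    using U(4) assms(3) by (intro Ck_on_cong[OF op]) auto
  ultimately show "\<exists>V. open V \<and> x \<in> V \<and> Ck_on k V (\<alpha> \<circ> \<pi>)"
    using op U(2) by blast
qed

text \<open>The derivative of a local extension is also a derivative of \<open>\<alpha>\<close>
  within \<open>N\<close>. Hence the choice made by \<open>frechet_derivative\<close> within
  \<open>N\<close> does yield a derivative.\<close>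

lemma smooth_on_submanifold_differentiable:
  assumes "smooth_fun_on_submanifold N \<alpha>" "p \<in> N"
  shows "\<alpha> differentiable (at p within N)"
proof -
  obtain U F where U: "open U" "p \<in> U" "smooth_on U F" "\<And>y. y \<in> U \<inter> N \<Longrightarrow> F y = \<alpha> y"
    using bspec[OF assms(1)[unfolded smooth_fun_on_submanifold_def] assms(2)] by auto
  obtain e where e: "e > 0" "ball p e \<subseteq> U" using U(1,2) open_contains_ball by blast
  have "(F has_derivative frechet_derivative F (at p)) (at p within N)"
    using smooth_on_has_derivative[OF U(3,2)] has_derivative_at_withinI by blast
  then have "(\<alpha> has_derivative frechet_derivative F (at p)) (at p within N)"
    using e U(4) by (elim has_derivative_transform_within[OF _ e(1) assms(2)])
      (auto simp: dist_commute subset_iff)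
  then show ?thesis by (auto simp: differentiable_def)
qed

section \<open>Uniqueness of integral curves\<close>

text \<open>The norms of the partial derivatives have a bounded sum on the compact closed ball. That
  sum bounds the operator norm, and the mean value inequality on the convex open ball turns it into
  a Lipschitz constant.\<close>

lemma smooth_on_lipschitz_ball:
  fixes g :: "'a::euclidean_space \<Rightarrow> 'b::real_normed_vector"
  assumes "smooth_on UNIV g"
  obtains L where "L \<ge> 0"
    "\<And>x y. x \<in> ball p 1 \<Longrightarrow> y \<in> ball p 1 \<Longrightarrow> norm (g x - g y) \<le> L * norm (x - y)"
proof -
  let ?D = "\<lambda>x. frechet_derivative g (at x)"
  have der: "(g has_derivative ?D x) (at x)" for x
    using smooth_on_has_derivative[OF assms] by simp
  have "continuous_on UNIV (\<lambda>x. ?D x b)" for b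
    by (intro smooth_on_continuous_on smooth_on_frechet_derivative assms)
  then have "continuous_on (cball p 1) (\<lambda>x. \<Sum>b\<in>Basis. norm (?D x b))"
    by (intro continuous_on_sum continuous_on_norm) (auto intro: continuous_on_subset)
  then have "compact ((\<lambda>x. \<Sum>b\<in>Basis. norm (?D x b)) ` cball p 1)"
    by (intro compact_continuous_image) auto
  then obtain L where L: "\<And>x. x \<in> cball p 1 \<Longrightarrow> (\<Sum>b\<in>Basis. norm (?D x b)) \<le> L"
    by (meson bounded_imp_bdd_above bdd_above.E compact_imp_bounded imageI)
  have "norm (?D x v) \<le> L * norm v" if x: "x \<in> cball p 1" for x v
  proof -
    have "norm (?D x v) \<le> (\<Sum>b\<in>Basis. norm ((v \<bullet> b) *\<^sub>R ?D x b))"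
      unfolding linear_basis_expansion[OF has_derivative_linear[OF der[of x]], of v]
      by (rule norm_sum)
    also have "\<dots> \<le> (\<Sum>b\<in>Basis. norm v * norm (?D x b))"
      by (intro sum_mono) (simp add: Basis_le_norm mult_right_mono)
    also have "\<dots> = norm v * (\<Sum>b\<in>Basis. norm (?D x b))"
      by (simp add: sum_distrib_left)
    also have "\<dots> \<le> L * norm v"
      using L[OF x] by (metis mult.commute mult_left_mono norm_ge_zero)
    finally show ?thesis .
  qed
  then have "onorm (?D x) \<le> L" if "x \<in> ball p 1" for x
    using that by (intro onorm_le) auto
  then have "norm (g x - g y) \<le> L * norm (x - y)" if "x \<in> ball p 1" "y \<in> ball p 1" for x y
    by (intro differentiable_bound[OF convex_ball[of p 1]])
      (use that der has_derivative_at_withinI in blast)+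
  moreover have "0 \<le> L"
    using order_trans[OF sum_nonneg L[of p]] by simp
  ultimately show thesis using that by blast
qed

lemma integral_curve_continuous:
  assumes "integral_curve g J \<gamma>" "t \<in> J"
  shows "continuous (at t) \<gamma>"
  using assms unfolding integral_curve_def
  using has_vector_derivative_continuous by blast

text \<open>The uniqueness half of the Picard-Lindeloef theorem: a contraction estimate for the
  difference of the curves on a short interval, based on the local Lipschitz bound for
  \<open>g\<close>.\<close>

lemma integral_curves_agree_locally:
  fixes g :: "real^'n::finite \<Rightarrow> real^'n"
  assumes g: "smooth_on UNIV g"
    and c1: "integral_curve g J \<gamma>" and c2: "integral_curve g J' \<gamma>'"
    and t0: "t\<^sub>0 \<in> J \<inter> J'" "\<gamma> t\<^sub>0 = \<gamma>' t\<^sub>0"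
  shows "\<exists>d>0. \<forall>t. \<bar>t - t\<^sub>0\<bar> < d \<longrightarrow> \<gamma> t = \<gamma>' t"
proof -
  obtain L where L: "L \<ge> 0" "\<And>x y. x \<in> ball (\<gamma> t\<^sub>0) 1 \<Longrightarrow> y \<in> ball (\<gamma> t\<^sub>0) 1
      \<Longrightarrow> norm (g x - g y) \<le> L * norm (x - y)"
    using smooth_on_lipschitz_ball[OF g] by blast
  have "open (J \<inter> J')" using c1 c2 by (auto simp: integral_curve_def)
  then have ev1: "\<forall>\<^sub>F t in nhds t\<^sub>0. t \<in> J \<inter> J'"
    using eventually_nhds_in_open t0(1) by blast
  \<comment> \<open>Limits along \<open>nhds\<close> rather than \<open>at\<close> make the
    neighbourhoods below contain the initial time itself.\<close>
  have "(\<gamma> \<longlongrightarrow> \<gamma> t\<^sub>0) (nhds t\<^sub>0)" "(\<gamma>' \<longlongrightarrow> \<gamma> t\<^sub>0) (nhds t\<^sub>0)"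
    using integral_curve_continuous[OF c1, of t\<^sub>0] integral_curve_continuous[OF c2, of t\<^sub>0] t0
    unfolding continuous_at tendsto_at_iff_tendsto_nhds by simp_all
  then have ev2: "\<forall>\<^sub>F t in nhds t\<^sub>0. \<gamma> t \<in> ball (\<gamma> t\<^sub>0) 1" "\<forall>\<^sub>F t in nhds t\<^sub>0. \<gamma>' t \<in> ball (\<gamma> t\<^sub>0) 1"
    by (auto dest!: tendstoD[where e = 1] simp: dist_commute)
  obtain e where e: "e > 0" "\<And>t. dist t t\<^sub>0 < e \<Longrightarrow>
      t \<in> J \<inter> J' \<and> \<gamma> t \<in> ball (\<gamma> t\<^sub>0) 1 \<and> \<gamma>' t \<in> ball (\<gamma> t\<^sub>0) 1"
    using eventually_conj[OF ev1 eventually_conj[OF ev2]] unfolding eventually_nhds_metric by auto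
  \<comment> \<open>The first bound keeps the closed interval of radius \<open>d\<close> inside the
    \<open>e\<close>-neighbourhood. In the second, \<open>L + 1\<close> avoids division by zero if
    \<open>L = 0\<close> and still gives \<open>L * d < 1\<close>.\<close>
  define d where "d = min (e / 2) (1 / (2 * (L + 1)))"
  have d: "d > 0" "d < e" "L * d < 1"
  proof -
    show "d > 0" "d < e" using e(1) L(1) by (auto simp: d_def min_less_iff_disj)
    have "L * d \<le> L * (1 / (2 * (L + 1)))"
      using L(1) by (intro mult_left_mono) (auto simp: d_def)
    also have "\<dots> < 1" using L(1) by (simp add: field_simps)
    finally show "L * d < 1" .
  qed
  define I where "I = cball t\<^sub>0 d"
  have I: "t \<in> J" "t \<in> J'" "\<gamma> t \<in> ball (\<gamma> t\<^sub>0) 1" "\<gamma>' t \<in> ball (\<gamma> t\<^sub>0) 1" if "t \<in> I" for t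
    using e(2)[of t] d(2) that by (auto simp: I_def dist_commute)
  define h where "h t = \<gamma> t - \<gamma>' t" for t
  have hder: "(h has_derivative (\<lambda>s. s *\<^sub>R (g (\<gamma> t) - g (\<gamma>' t)))) (at t within I)" if "t \<in> I" for t
  proof -
    have "(h has_vector_derivative g (\<gamma> t) - g (\<gamma>' t)) (at t)"
      unfolding h_def using c1 c2 I[OF that]
      by (intro has_vector_derivative_diff) (auto simp: integral_curve_def)
    then show ?thesis
      unfolding has_vector_derivative_def by (rule has_derivative_at_withinI)
  qed
  have "continuous_on I (\<lambda>t. norm (h t))"
    using hder by (intro continuous_on_norm has_derivative_continuous_on)
  moreover have "compact I" "I \<noteq> {}" using d(1) by (auto simp: I_def)
  ultimately obtain t1 where t1: "t1 \<in> I" "\<And>t. t \<in> I \<Longrightarrow> norm (h t) \<le> norm (h t1)"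
    using continuous_attains_sup by metis
  \<comment> \<open>The mean value inequality bounds the maximum of \<open>norm \<circ> h\<close> by \<open>L * d < 1\<close> times itself.\<close>
  have "norm (h t1 - h t\<^sub>0) \<le> (L * norm (h t1)) * norm (t1 - t\<^sub>0)"
  proof (rule differentiable_bound[OF _ hder])
    show "convex I" by (simp add: I_def)
    show "onorm (\<lambda>s. s *\<^sub>R (g (\<gamma> t) - g (\<gamma>' t))) \<le> L * norm (h t1)" if "t \<in> I" for t
    proof (rule onorm_le)
      fix s :: real
      have "norm (g (\<gamma> t) - g (\<gamma>' t)) \<le> L * norm (h t)"
        unfolding h_def using L(2) I[OF that] by blast
      also have "\<dots> \<le> L * norm (h t1)" using t1(2)[OF that] L(1) by (intro mult_left_mono)
      finally show "norm (s *\<^sub>R (g (\<gamma> t) - g (\<gamma>' t))) \<le> L * norm (h t1) * norm s"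
        by (simp add: mult.commute mult_left_mono)
    qed
  qed (use t1(1) d(1) in \<open>auto simp: I_def\<close>)
  also have "\<dots> \<le> (L * norm (h t1)) * d"
    using t1(1) L(1) by (intro mult_left_mono) (auto simp: I_def dist_norm norm_minus_commute)
  finally have "norm (h t1) \<le> (L * d) * norm (h t1)"
    using t0(2) by (simp add: h_def mult_ac)
  then have "(1 - L * d) * norm (h t1) \<le> 0" by (simp add: algebra_simps)
  then have "norm (h t1) = 0"
    using d(3) by (metis diff_gt_0_iff_gt mult_le_0_iff not_less norm_le_zero_iff norm_zero)
  then have "\<gamma> t = \<gamma>' t" if "t \<in> I" for t using t1(2)[OF that] by (simp add: h_def)
  then show ?thesis using d(1) by (intro exI[of _ d]) (auto simp: I_def dist_real_def)
qed

text \<open>A connectedness argument: the set of agreement is open by local uniqueness, closed by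
  continuity, and nonempty.\<close>

lemma integral_curves_agree:
  fixes g :: "real^'n::finite \<Rightarrow> real^'n"
  assumes g: "smooth_on UNIV g"
    and c1: "integral_curve g J \<gamma>" and c2: "integral_curve g J' \<gamma>'"
    and t0: "t\<^sub>0 \<in> J \<inter> J'" "\<gamma> t\<^sub>0 = \<gamma>' t\<^sub>0" and t: "t \<in> J \<inter> J'"
  shows "\<gamma> t = \<gamma>' t"
proof -
  \<comment> \<open>Agreement is phrased as a vanishing difference, so that \<open>?A\<close> is the
    preimage of a constant under one continuous map.\<close>
  let ?A = "{t \<in> J \<inter> J'. \<gamma> t - \<gamma>' t = 0}"
  have conn: "connected (J \<inter> J')"
    using c1 c2 by (auto simp: integral_curve_def is_interval_connected_1[symmetric] is_interval_Int)
  have opJ: "open (J \<inter> J')" using c1 c2 by (auto simp: integral_curve_def)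
  have "open ?A"
    unfolding open_dist
  proof
    fix s assume s: "s \<in> ?A"
    then obtain d where d: "d > 0" "\<And>t. \<bar>t - s\<bar> < d \<Longrightarrow> \<gamma> t = \<gamma>' t"
      using integral_curves_agree_locally[OF g c1 c2, of s] by auto
    obtain e where e: "e > 0" "\<And>t. dist t s < e \<Longrightarrow> t \<in> J \<inter> J'"
      using opJ s unfolding open_dist by blast
    show "\<exists>e>0. \<forall>y. dist y s < e \<longrightarrow> y \<in> ?A"
      using d e by (intro exI[of _ "min d e"]) (auto simp: dist_real_def)
  qed
  then have "openin (top_of_set (J \<inter> J')) ?A" by (intro openin_open_eq[THEN iffD2] opJ conjI) auto
  moreover have "closedin (top_of_set (J \<inter> J')) ?A"
    by (intro continuous_closedin_preimage_constant continuous_on_diff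
        continuous_at_imp_continuous_on)
      (auto intro: integral_curve_continuous[OF c1] integral_curve_continuous[OF c2])
  ultimately have "?A = {} \<or> ?A = J \<inter> J'"
    using conn unfolding connected_clopen by blast
  then show ?thesis using t0 t by auto
qed

section \<open>Maximal curves and the projection\<close>

lemma integral_curve_shift:
  assumes "integral_curve g J \<gamma>"
  shows "integral_curve g ((\<lambda>t. t + c) ` J) (\<lambda>t. \<gamma> (t - c))"
  unfolding integral_curve_def
proof (intro conjI ballI)
  have J: "open J" "connected J" "J \<noteq> {}"
    using assms by (auto simp: integral_curve_def is_interval_connected_1)
  show "open ((\<lambda>t. t + c) ` J)"
    using open_translation[OF J(1), of c] by (simp add: add.commute)
  show "is_interval ((\<lambda>t. t + c) ` J)"
    unfolding is_interval_connected_1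
    by (intro connected_continuous_image continuous_intros J)
  show "(\<lambda>t. t + c) ` J \<noteq> {}" using J(3) by simp
next
  fix t assume "t \<in> (\<lambda>t. t + c) ` J"
  then have "(\<gamma> has_vector_derivative g (\<gamma> (t - c))) (at (t - c))"
    using assms by (auto simp: integral_curve_def)
  moreover have "((\<lambda>t. t - c) has_vector_derivative 1) (at t)"
    by (auto intro!: derivative_eq_intros)
  ultimately show "((\<lambda>t. \<gamma> (t - c)) has_vector_derivative g (\<gamma> (t - c))) (at t)"
    using vector_diff_chain_at[of "\<lambda>t. t - c" 1 t \<gamma>] by (simp add: o_def)
qed

text \<open>After a shift of the parameter the two curves meet at the same time and can be glued.
  The result extends the maximal curve, so it cannot have a larger domain.\<close>

lemma integral_curve_image_subset_maximal:
  fixes g :: "real^'n::finite \<Rightarrow> real^'n"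
  assumes g: "smooth_on UNIV g"
    and c1: "maximal_integral_curve g J \<gamma>" and c2: "integral_curve g J' \<gamma>'"
    and meet: "\<gamma> ` J \<inter> \<gamma>' ` J' \<noteq> {}"
  shows "\<gamma>' ` J' \<subseteq> \<gamma> ` J"
proof -
  obtain s s' where s: "s \<in> J" "s' \<in> J'" "\<gamma> s = \<gamma>' s'" using meet by auto
  \<comment> \<open>The shift by \<open>s - s'\<close> moves the meeting time of the second curve to
    \<open>s\<close>.\<close>
  define K where "K = (\<lambda>t. t + (s - s')) ` J'"
  define \<delta> where "\<delta> t = \<gamma>' (t - (s - s'))" for t
  have cd: "integral_curve g K \<delta>"
    unfolding K_def \<delta>_def by (rule integral_curve_shift[OF c2])
  have c: "integral_curve g J \<gamma>" using c1 by (simp add: maximal_integral_curve_def)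
  have sK: "s \<in> K" "\<gamma> s = \<delta> s" using s by (auto simp: K_def \<delta>_def image_iff)
  have agree: "\<gamma> t = \<delta> t" if "t \<in> J" "t \<in> K" for t
    using integral_curves_agree[OF g c cd, of s t] s(1) sK that by blast
  \<comment> \<open>The glued curve; by \<open>agree\<close>, preferring \<open>\<gamma>\<close> on
    the overlap is immaterial.\<close>
  define \<epsilon> where "\<epsilon> t = (if t \<in> J then \<gamma> t else \<delta> t)" for t
  have \<epsilon>: "\<epsilon> t = \<gamma> t" if "t \<in> J" for t using that by (simp add: \<epsilon>_def)
  have \<epsilon>': "\<epsilon> t = \<delta> t" if "t \<in> K" for t using that agree by (simp add: \<epsilon>_def)
  have "integral_curve g (J \<union> K) \<epsilon>"
    unfolding integral_curve_def
  proof (intro conjI ballI)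
    show "open (J \<union> K)" "J \<union> K \<noteq> {}" using c cd by (auto simp: integral_curve_def)
    show "is_interval (J \<union> K)"
      using c cd s(1) sK(1) unfolding integral_curve_def is_interval_connected_1
      by (intro connected_Un) auto
  next
    fix t assume "t \<in> J \<union> K"
    then consider "t \<in> J" | "t \<in> K" by blast
    then show "(\<epsilon> has_vector_derivative g (\<epsilon> t)) (at t)"
    proof cases
      case 1
      then have "(\<gamma> has_vector_derivative g (\<epsilon> t)) (at t)" "open J"
        using c \<epsilon> by (auto simp: integral_curve_def)
      then show ?thesis
        by (rule has_vector_derivative_transform_within_open) (use 1 \<epsilon> in auto)
    next
      case 2
      then have "(\<delta> has_vector_derivative g (\<epsilon> t)) (at t)" "open K"
        using cd \<epsilon>' by (auto simp: integral_curve_def)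
      then show ?thesis
        by (rule has_vector_derivative_transform_within_open) (use 2 \<epsilon>' in auto)
    qed
  qed
  then have "K \<subseteq> J"
    using c1 \<epsilon> unfolding maximal_integral_curve_def by blast
  show ?thesis
  proof
    fix y assume "y \<in> \<gamma>' ` J'"
    then obtain r where r: "r \<in> J'" "y = \<gamma>' r" by blast
    then have "r + (s - s') \<in> K" "\<delta> (r + (s - s')) = y" by (auto simp: K_def \<delta>_def)
    then show "y \<in> \<gamma> ` J" using agree \<open>K \<subseteq> J\<close> by (metis imageI subsetD)
  qed
qed

text \<open>Along the integral curve through \<open>x\<close> the map \<open>\<pi>\<close> is
  constant, and differentiating this at the time when the curve passes \<open>x\<close> gives the
  claim.\<close>

lemma projection_along_derivative_zero:
  fixes g :: "real^'n::finite \<Rightarrow> real^'n"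
  assumes g: "smooth_on UNIV g" and \<pi>: "projection_along g N \<pi>"
    and unique: "\<forall>J \<gamma>. maximal_integral_curve g J \<gamma> \<longrightarrow> (\<exists>!p. p \<in> \<gamma> ` J \<inter> N)"
    and der: "(\<pi> has_derivative D) (at x)"
  shows "D (g x) = 0"
proof -
  obtain J \<gamma> where c: "maximal_integral_curve g J \<gamma>" "x \<in> \<gamma> ` J" "\<pi> x \<in> \<gamma> ` J \<inter> N"
    using \<pi> unfolding projection_along_def by blast
  obtain t\<^sub>0 where t0: "t\<^sub>0 \<in> J" "\<gamma> t\<^sub>0 = x" using c(2) by blast
  have const: "\<pi> (\<gamma> t) = \<pi> x" if "t \<in> J" for t
  proof -
    obtain J' \<gamma>' where c': "maximal_integral_curve g J' \<gamma>'" "\<gamma> t \<in> \<gamma>' ` J'"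
        "\<pi> (\<gamma> t) \<in> \<gamma>' ` J' \<inter> N"
      using \<pi> unfolding projection_along_def by blast
    \<comment> \<open>\<open>projection_along\<close> may supply another curve for
      \<open>\<gamma> t\<close>. Its image lies in that of \<open>\<gamma>\<close>, so both values
      of \<open>\<pi>\<close> lie in the same one-point intersection with \<open>N\<close>.\<close>
    have "\<gamma>' ` J' \<subseteq> \<gamma> ` J"
      using integral_curve_image_subset_maximal[OF g c(1), of J' \<gamma>'] c'(1,2) that
      unfolding maximal_integral_curve_def by blast
    then show ?thesis using unique c(1,3) c'(3) by blast
  qed
  have J: "open J" and vd: "(\<gamma> has_vector_derivative g x) (at t\<^sub>0)"
    using c(1) t0 unfolding maximal_integral_curve_def integral_curve_def by auto
  have "((\<lambda>t. \<pi> (\<gamma> t)) has_derivative (\<lambda>s. D (s *\<^sub>R g x))) (at t\<^sub>0)"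
    using has_derivative_compose[OF vd[unfolded has_vector_derivative_def], of \<pi> D] der t0(2)
    by simp
  moreover have "((\<lambda>t. \<pi> (\<gamma> t)) has_derivative (\<lambda>s. 0)) (at t\<^sub>0)"
    by (rule has_derivative_transform_within_open[OF has_derivative_const[of "\<pi> x"] J t0(1)])
      (simp add: const)
  ultimately have "(\<lambda>s. D (s *\<^sub>R g x)) = (\<lambda>s. 0)" by (rule has_derivative_unique)
  then show ?thesis by (metis scaleR_one)
qed

section \<open>The modified bracket on representatives\<close>

lemma frechet_derivative_add_scaleR:
  fixes X Y :: "'a::real_normed_vector \<Rightarrow> 'b::real_normed_vector" and \<beta> :: "'a \<Rightarrow> real"
  assumes "X differentiable (at x)" "Y differentiable (at x)" "\<beta> differentiable (at x)"
  shows "frechet_derivative (\<lambda>x. X x + \<beta> x *\<^sub>R Y x) (at x) v = frechet_derivative X (at x) v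
    + \<beta> x *\<^sub>R frechet_derivative Y (at x) v + frechet_derivative \<beta> (at x) v *\<^sub>R Y x"
proof -
  have "((\<lambda>x. X x + \<beta> x *\<^sub>R Y x) has_derivative (\<lambda>v. frechet_derivative X (at x) v
      + (\<beta> x *\<^sub>R frechet_derivative Y (at x) v + frechet_derivative \<beta> (at x) v *\<^sub>R Y x))) (at x)"
    using assms unfolding frechet_derivative_works
    by (intro has_derivative_add has_derivative_scaleR)
  from fun_cong[OF frechet_derivative_at[OF this], of v] show ?thesis by (simp add: add.assoc)
qed

lemma smooth_on_UNIV_differentiable: "smooth_on UNIV f \<Longrightarrow> f differentiable (at x)"
  unfolding differentiable_def using smooth_on_has_derivative by blast

lemma smooth_on_UNIV_linear: "smooth_on UNIV f \<Longrightarrow> linear (frechet_derivative f (at x))"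
  using smooth_on_has_derivative has_derivative_linear by blast

lemma smooth_on_lie_bracket:
  "smooth_on UNIV X \<Longrightarrow> smooth_on UNIV Y \<Longrightarrow> smooth_on UNIV (lie_bracket X Y)"
  unfolding lie_bracket_def by (intro smooth_on_diff smooth_on_frechet_derivative_apply open_UNIV)

text \<open>The \<open>field_class\<close> of a map that is not smooth is empty, so smoothness of
  the bracket has to be known before its class is formed.\<close>

lemma smooth_on_modified_bracket:
  assumes "smooth_on UNIV g" "smooth_on UNIV \<omega>" "\<forall>x. blinfun_apply (\<omega> x) (g x) \<noteq> 0"
    and "smooth_on UNIV X" "smooth_on UNIV Y"
  shows "smooth_on UNIV (modified_bracket g \<omega> X Y)"
  unfolding modified_bracket_def
  by (intro smooth_on_diff smooth_on_add smooth_on_scaleR smooth_on_divide smooth_on_lie_bracket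
      smooth_on_blinfun_apply open_UNIV) (use assms in auto)

lemma lie_bracket_swap: "lie_bracket X Y x = - lie_bracket Y X x"
  by (simp add: lie_bracket_def)

text \<open>One formula for two uses: \<open>Y = 0\<close> gives the Leibniz rule, and
  \<open>Z = g\<close> describes a change of representative.\<close>

lemma lie_bracket_add_scaleR:
  fixes X Y Z :: "real^'n::finite \<Rightarrow> real^'n" and \<beta> :: "real^'n \<Rightarrow> real"
  assumes "smooth_on UNIV X" "smooth_on UNIV Y" "smooth_on UNIV Z" "smooth_on UNIV \<beta>"
  shows "lie_bracket X (\<lambda>x. Y x + \<beta> x *\<^sub>R Z x) x
    = lie_bracket X Y x + \<beta> x *\<^sub>R lie_bracket X Z x + frechet_derivative \<beta> (at x) (X x) *\<^sub>R Z x"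
  using assms unfolding lie_bracket_def
  by (simp add: frechet_derivative_add_scaleR smooth_on_UNIV_differentiable
      linear_add[OF smooth_on_UNIV_linear] linear_cmul[OF smooth_on_UNIV_linear] algebra_simps)

text \<open>Independence of the representatives, with the coefficient of \<open>g\<close> made
  explicit so that its smoothness can be verified afterwards.\<close>

lemma modified_bracket_add_multiple:
  fixes g X Y :: "real^'n::finite \<Rightarrow> real^'n" and \<beta> \<gamma> :: "real^'n \<Rightarrow> real"
  assumes g: "smooth_on UNIV g" and \<omega>g: "\<forall>x. blinfun_apply (\<omega> x) (g x) \<noteq> 0"
    and X: "smooth_on UNIV X" and Y: "smooth_on UNIV Y"
    and \<beta>: "smooth_on UNIV \<beta>" and \<gamma>: "smooth_on UNIV \<gamma>"
  shows "modified_bracket g \<omega> (\<lambda>x. X x + \<beta> x *\<^sub>R g x) (\<lambda>x. Y x + \<gamma> x *\<^sub>R g x) x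
    = modified_bracket g \<omega> X Y x
      + (frechet_derivative \<gamma> (at x) (X x) - frechet_derivative \<beta> (at x) (Y x)
         + blinfun_apply (\<omega> x) (Y x) / blinfun_apply (\<omega> x) (g x) * frechet_derivative \<beta> (at x) (g x)
         - blinfun_apply (\<omega> x) (X x) / blinfun_apply (\<omega> x) (g x) * frechet_derivative \<gamma> (at x) (g x))
        *\<^sub>R g x"
proof -
  let ?X = "\<lambda>x. X x + \<beta> x *\<^sub>R g x" and ?Y = "\<lambda>x. Y x + \<gamma> x *\<^sub>R g x"
  have X': "smooth_on UNIV ?X" by (intro smooth_on_add smooth_on_scaleR open_UNIV X \<beta> g)
  have gg: "lie_bracket g g x = 0" by (simp add: lie_bracket_def)
  have gX: "lie_bracket g ?X x = lie_bracket g X x + frechet_derivative \<beta> (at x) (g x) *\<^sub>R g x"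
    using lie_bracket_add_scaleR[OF g X g \<beta>] gg by simp
  have gY: "lie_bracket g ?Y x = lie_bracket g Y x + frechet_derivative \<gamma> (at x) (g x) *\<^sub>R g x"
    using lie_bracket_add_scaleR[OF g Y g \<gamma>] gg by simp
  have YX: "lie_bracket Y ?X x = - lie_bracket X Y x - \<beta> x *\<^sub>R lie_bracket g Y x
      + frechet_derivative \<beta> (at x) (Y x) *\<^sub>R g x"
    using lie_bracket_add_scaleR[OF Y X g \<beta>] lie_bracket_swap[of X Y x] lie_bracket_swap[of g Y x]
    by simp
  \<comment> \<open>The second argument is expanded first; antisymmetry then moves \<open>?X\<close>
    into the second slot, where the same rule expands it.\<close>
  have XY: "lie_bracket ?X ?Y x = lie_bracket X Y x + \<beta> x *\<^sub>R lie_bracket g Y x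
      - frechet_derivative \<beta> (at x) (Y x) *\<^sub>R g x
      - \<gamma> x *\<^sub>R (lie_bracket g X x + frechet_derivative \<beta> (at x) (g x) *\<^sub>R g x)
      + (frechet_derivative \<gamma> (at x) (X x) + \<beta> x * frechet_derivative \<gamma> (at x) (g x)) *\<^sub>R g x"
    unfolding lie_bracket_add_scaleR[OF X' Y g \<gamma>] lie_bracket_swap[of ?X Y] lie_bracket_swap[of ?X g]
      gX YX
    using \<gamma> by (simp add: linear_add[OF smooth_on_UNIV_linear] linear_cmul[OF smooth_on_UNIV_linear]
        algebra_simps)
  \<comment> \<open>Adding \<open>c\<close> times \<open>g\<close> shifts the quotient by exactly
    \<open>c\<close>. These shifts produce the terms that cancel the brackets with \<open>g\<close>
    in \<open>XY\<close>.\<close>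
  have quot: "blinfun_apply (\<omega> x) (Z x + c *\<^sub>R g x) / blinfun_apply (\<omega> x) (g x)
      = blinfun_apply (\<omega> x) (Z x) / blinfun_apply (\<omega> x) (g x) + c" for Z c
    using \<omega>g by (simp add: blinfun.add_right blinfun.scaleR_right add_divide_distrib)
  \<comment> \<open>With the quotients as opaque coefficients, what remains is an identity in a real
    vector space.\<close>
  define p where "p = blinfun_apply (\<omega> x) (X x) / blinfun_apply (\<omega> x) (g x)"
  define q where "q = blinfun_apply (\<omega> x) (Y x) / blinfun_apply (\<omega> x) (g x)"
  show ?thesis
    unfolding modified_bracket_def quot gX gY XY p_def[symmetric] q_def[symmetric]
    by (simp add: algebra_simps)
qed

text \<open>\<open>\<omega>\<close> is linear, so the first correction term scales by
  \<open>f\<close>; the second does too, because \<open>f\<close> has zero derivative along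
  \<open>g\<close>. Only \<open>[X, f Y]\<close> contributes a derivative of
  \<open>f\<close>.\<close>

lemma modified_bracket_scaleR_right:
  fixes g X Y :: "real^'n::finite \<Rightarrow> real^'n" and f :: "real^'n \<Rightarrow> real"
  assumes "smooth_on UNIV g" "smooth_on UNIV X" "smooth_on UNIV Y" "smooth_on UNIV f"
    and gf: "frechet_derivative f (at x) (g x) = 0"
  shows "modified_bracket g \<omega> X (\<lambda>x. f x *\<^sub>R Y x) x
    = f x *\<^sub>R modified_bracket g \<omega> X Y x + frechet_derivative f (at x) (X x) *\<^sub>R Y x"
proof -
  have leibniz: "lie_bracket Z (\<lambda>x. f x *\<^sub>R Y x) x
      = f x *\<^sub>R lie_bracket Z Y x + frechet_derivative f (at x) (Z x) *\<^sub>R Y x"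
    if "smooth_on UNIV Z" for Z
  proof -
    have "lie_bracket Z (\<lambda>x. 0) x = 0"
      by (simp add: lie_bracket_def linear_0[OF smooth_on_UNIV_linear[OF that]])
    then show ?thesis
      using lie_bracket_add_scaleR[OF that smooth_on_const[of UNIV 0] assms(3,4), of x] by simp
  qed
  show ?thesis
    unfolding modified_bracket_def leibniz[OF assms(1)] leibniz[OF assms(2)] gf
    by (simp add: blinfun.scaleR_right algebra_simps)
qed

section \<open>Classes modulo multiples of g\<close>

lemma equiv_cong_mod:
  fixes g :: "real^'n::finite \<Rightarrow> real^'n"
  shows "equiv vector_fields (cong_mod g)"
proof (rule equivI)
  show "cong_mod g \<subseteq> vector_fields \<times> vector_fields" by (auto simp: cong_mod_def)
  show "refl_on vector_fields (cong_mod g)"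
    by (auto simp: refl_on_def cong_mod_def intro!: exI[of _ "\<lambda>x. 0"] smooth_on_const)
  show "sym (cong_mod g)"
  proof (rule symI)
    fix m m' assume "(m, m') \<in> cong_mod g"
    then obtain \<beta> where "m \<in> vector_fields" "m' \<in> vector_fields"
        "smooth_on UNIV \<beta>" "\<And>x. m' x = m x + \<beta> x *\<^sub>R g x"
      by (auto simp: cong_mod_def)
    then show "(m', m) \<in> cong_mod g"
      by (auto simp: cong_mod_def intro!: exI[of _ "\<lambda>x. - \<beta> x"] smooth_on_minus)
  qed
  show "trans (cong_mod g)"
  proof (rule transI)
    fix m m' m'' assume "(m, m') \<in> cong_mod g" "(m', m'') \<in> cong_mod g"
    then obtain \<beta> \<gamma> where "m \<in> vector_fields" "m'' \<in> vector_fields"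
        "smooth_on UNIV \<beta>" "\<And>x. m' x = m x + \<beta> x *\<^sub>R g x"
        "smooth_on UNIV \<gamma>" "\<And>x. m'' x = m' x + \<gamma> x *\<^sub>R g x"
      by (auto simp: cong_mod_def)
    then show "(m, m'') \<in> cong_mod g"
      by (auto simp: cong_mod_def algebra_simps intro!: exI[of _ "\<lambda>x. \<beta> x + \<gamma> x"] smooth_on_add)
  qed
qed

lemma field_class_memE:
  assumes "m' \<in> field_class g m"
  obtains \<beta> where "smooth_on UNIV m" "smooth_on UNIV m'" "smooth_on UNIV \<beta>"
    "m' = (\<lambda>x. m x + \<beta> x *\<^sub>R g x)"
proof -
  obtain \<beta> where "smooth_on UNIV m" "smooth_on UNIV m'" "smooth_on UNIV \<beta>"
      "\<forall>x. m' x = m x + \<beta> x *\<^sub>R g x"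
    using assms by (auto simp: field_class_def cong_mod_def vector_fields_def)
  then show thesis by (intro that[of \<beta>] ext) simp_all
qed

lemma field_class_self: "smooth_on UNIV m \<Longrightarrow> m \<in> field_class g m"
  unfolding field_class_def by (rule equiv_class_self[OF equiv_cong_mod]) (simp add: vector_fields_def)

lemma field_class_eqI:
  assumes "smooth_on UNIV m" "smooth_on UNIV m'" "smooth_on UNIV \<beta>"
    "\<And>x. m' x = m x + \<beta> x *\<^sub>R g x"
  shows "field_class g m' = field_class g m"
  unfolding field_class_def
  by (rule equiv_class_eq[OF equiv_cong_mod, symmetric])
    (use assms in \<open>auto simp: cong_mod_def vector_fields_def\<close>)

text \<open>All classes in the union coincide, as the coefficients of \<open>g\<close> add up, and
  the union is nonempty because each field lies in its own class. The same pattern serves scaling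
  and the bracket.\<close>

lemma class_add_field_class:
  fixes m\<^sub>1 m\<^sub>2 :: "real^'n::finite \<Rightarrow> real^'n"
  assumes "smooth_on UNIV m\<^sub>1" "smooth_on UNIV m\<^sub>2"
  shows "class_add g (field_class g m\<^sub>1) (field_class g m\<^sub>2) = field_class g (\<lambda>x. m\<^sub>1 x + m\<^sub>2 x)"
proof -
  have "field_class g (\<lambda>x. n\<^sub>1 x + n\<^sub>2 x) = field_class g (\<lambda>x. m\<^sub>1 x + m\<^sub>2 x)"
    if n: "n\<^sub>1 \<in> field_class g m\<^sub>1" "n\<^sub>2 \<in> field_class g m\<^sub>2" for n\<^sub>1 n\<^sub>2
  proof -
    obtain \<beta> where \<beta>: "smooth_on UNIV m\<^sub>1" "smooth_on UNIV n\<^sub>1" "smooth_on UNIV \<beta>"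
        "n\<^sub>1 = (\<lambda>x. m\<^sub>1 x + \<beta> x *\<^sub>R g x)"
      by (rule field_class_memE[OF n(1)])
    obtain \<gamma> where \<gamma>: "smooth_on UNIV m\<^sub>2" "smooth_on UNIV n\<^sub>2" "smooth_on UNIV \<gamma>"
        "n\<^sub>2 = (\<lambda>x. m\<^sub>2 x + \<gamma> x *\<^sub>R g x)"
      by (rule field_class_memE[OF n(2)])
    show ?thesis
    proof (rule field_class_eqI)
      show "n\<^sub>1 x + n\<^sub>2 x = m\<^sub>1 x + m\<^sub>2 x + (\<beta> x + \<gamma> x) *\<^sub>R g x" for x
        by (simp add: \<beta>(4) \<gamma>(4) algebra_simps)
    qed (intro smooth_on_add open_UNIV \<beta>(1-3) \<gamma>(1-3))+
  qed
  then show ?thesis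
    unfolding class_add_def using assms by (intro UN_constant_eq[OF field_class_self] ballI) simp_all
qed

lemma class_scale_field_class:
  fixes m :: "real^'n::finite \<Rightarrow> real^'n"
  assumes "smooth_on UNIV f" "smooth_on UNIV m"
  shows "class_scale g f (field_class g m) = field_class g (\<lambda>x. f x *\<^sub>R m x)"
proof -
  have "field_class g (\<lambda>x. f x *\<^sub>R n x) = field_class g (\<lambda>x. f x *\<^sub>R m x)"
    if n: "n \<in> field_class g m" for n
  proof -
    obtain \<beta> where \<beta>: "smooth_on UNIV m" "smooth_on UNIV n" "smooth_on UNIV \<beta>"
        "n = (\<lambda>x. m x + \<beta> x *\<^sub>R g x)"
      by (rule field_class_memE[OF n])
    show ?thesis
    proof (rule field_class_eqI)
      show "f x *\<^sub>R n x = f x *\<^sub>R m x + (f x * \<beta> x) *\<^sub>R g x" for x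
        by (simp add: \<beta>(4) algebra_simps)
    qed (intro smooth_on_scaleR smooth_on_mult open_UNIV assms \<beta>(1-3))+
  qed
  then show ?thesis
    unfolding class_scale_def using assms(2) by (intro UN_constant_eq[OF field_class_self] ballI) simp_all
qed

lemma class_bracket_field_class:
  fixes g m\<^sub>1 m\<^sub>2 :: "real^'n::finite \<Rightarrow> real^'n"
  assumes g: "smooth_on UNIV g" and \<omega>: "smooth_on UNIV \<omega>"
    and \<omega>g: "\<forall>x. blinfun_apply (\<omega> x) (g x) \<noteq> 0"
    and m: "smooth_on UNIV m\<^sub>1" "smooth_on UNIV m\<^sub>2"
  shows "class_bracket g \<omega> (field_class g m\<^sub>1) (field_class g m\<^sub>2)
    = field_class g (modified_bracket g \<omega> m\<^sub>1 m\<^sub>2)"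
proof -
  have "field_class g (modified_bracket g \<omega> n\<^sub>1 n\<^sub>2) = field_class g (modified_bracket g \<omega> m\<^sub>1 m\<^sub>2)"
    if n: "n\<^sub>1 \<in> field_class g m\<^sub>1" "n\<^sub>2 \<in> field_class g m\<^sub>2" for n\<^sub>1 n\<^sub>2
  proof -
    obtain \<beta> where \<beta>: "smooth_on UNIV m\<^sub>1" "smooth_on UNIV n\<^sub>1" "smooth_on UNIV \<beta>"
        "n\<^sub>1 = (\<lambda>x. m\<^sub>1 x + \<beta> x *\<^sub>R g x)"
      by (rule field_class_memE[OF n(1)])
    obtain \<gamma> where \<gamma>: "smooth_on UNIV m\<^sub>2" "smooth_on UNIV n\<^sub>2" "smooth_on UNIV \<gamma>"
        "n\<^sub>2 = (\<lambda>x. m\<^sub>2 x + \<gamma> x *\<^sub>R g x)"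
      by (rule field_class_memE[OF n(2)])
    show ?thesis
    proof (rule field_class_eqI)
      show "smooth_on UNIV (modified_bracket g \<omega> m\<^sub>1 m\<^sub>2)"
        by (rule smooth_on_modified_bracket[OF g \<omega> \<omega>g m])
      show "smooth_on UNIV (modified_bracket g \<omega> n\<^sub>1 n\<^sub>2)"
        by (rule smooth_on_modified_bracket[OF g \<omega> \<omega>g \<beta>(2) \<gamma>(2)])
      show "modified_bracket g \<omega> n\<^sub>1 n\<^sub>2 x = modified_bracket g \<omega> m\<^sub>1 m\<^sub>2 x +
        (frechet_derivative \<gamma> (at x) (m\<^sub>1 x) - frechet_derivative \<beta> (at x) (m\<^sub>2 x)
         + blinfun_apply (\<omega> x) (m\<^sub>2 x) / blinfun_apply (\<omega> x) (g x) * frechet_derivative \<beta> (at x) (g x)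
         - blinfun_apply (\<omega> x) (m\<^sub>1 x) / blinfun_apply (\<omega> x) (g x) * frechet_derivative \<gamma> (at x) (g x))
        *\<^sub>R g x" for x
        unfolding \<beta>(4) \<gamma>(4) by (rule modified_bracket_add_multiple[OF g \<omega>g m \<beta>(3) \<gamma>(3)])
    \<comment> \<open>What is left is smoothness of the coefficient of \<open>g\<close>, without
      which the two brackets would not be congruent.\<close>
    qed (intro smooth_on_diff smooth_on_add smooth_on_mult smooth_on_divide smooth_on_blinfun_apply
        smooth_on_frechet_derivative_apply open_UNIV g \<omega> m \<beta>(3) \<gamma>(3) \<omega>g[rule_format])
  qed
  then show ?thesis
    unfolding class_bracket_def using m by (intro UN_constant_eq[OF field_class_self] ballI) simp_all
qed

text \<open>The derivative of \<open>\<pi>\<close> is linear and kills \<open>g\<close>, so all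
  representatives have the same image and \<open>the_elem\<close> is applied to a singleton.\<close>

lemma anchor_field_class:
  fixes g m :: "real^'n::finite \<Rightarrow> real^'n"
  assumes "smooth_on UNIV m" "smooth_on UNIV \<pi>"
    and "frechet_derivative \<pi> (at x) (g x) = 0"
  shows "anchor \<pi> (field_class g m) x = frechet_derivative \<pi> (at x) (m x)"
proof -
  have "frechet_derivative \<pi> (at x) (n x) = frechet_derivative \<pi> (at x) (m x)"
    if "n \<in> field_class g m" for n
    using that assms(2,3) by (elim field_class_memE)
      (simp add: linear_add[OF smooth_on_UNIV_linear] linear_cmul[OF smooth_on_UNIV_linear])
  then have "(\<lambda>n. frechet_derivative \<pi> (at x) (n x)) ` field_class g m
      = {frechet_derivative \<pi> (at x) (m x)}"
    using field_class_self[OF assms(1), of g] by blast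
  then show ?thesis by (simp add: anchor_def)
qed

text \<open>
  Since \<open>\<pi>\<close> maps into \<open>N\<close>, the chain rule holds for any choice of the derivative of \<open>\<alpha>\<close> within \<open>N\<close>,
  so its non-uniqueness off the tangent space does no harm.
\<close>

lemma frechet_derivative_compose_within:
  assumes "\<pi> differentiable (at x)" "range \<pi> \<subseteq> N" "\<alpha> differentiable (at (\<pi> x) within N)"
  shows "frechet_derivative (\<alpha> \<circ> \<pi>) (at x) v
    = frechet_derivative \<alpha> (at (\<pi> x) within N) (frechet_derivative \<pi> (at x) v)"
proof -
  \<comment> \<open>The chain rule asks for a derivative within the image of \<open>\<pi>\<close>,
    so the one within \<open>N\<close> is restricted to that subset.\<close>
  have "(\<alpha> has_derivative frechet_derivative \<alpha> (at (\<pi> x) within N)) (at (\<pi> x) within range \<pi>)"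
    using assms(2,3) by (auto simp: frechet_derivative_works intro: has_derivative_subset)
  then have "(\<alpha> \<circ> \<pi> has_derivative
      (frechet_derivative \<alpha> (at (\<pi> x) within N) \<circ> frechet_derivative \<pi> (at x))) (at x)"
    using assms(1) by (intro diff_chain_within) (auto simp: frechet_derivative_works)
  from fun_cong[OF frechet_derivative_at[OF this], of v] show ?thesis by simp
qed

section \<open>The Leibniz rule on classes\<close>

theorem lemma6:
  fixes g :: "real^'n::finite \<Rightarrow> real^'n"
    and \<omega> :: "'n one_form"
    and \<psi> \<mu> :: "real^'n \<Rightarrow> real"
    and N :: "(real^'n) set"
    and \<pi> :: "real^'n \<Rightarrow> real^'n"
    and \<alpha> :: "real^'n \<Rightarrow> real"
    and M\<^sub>1 M\<^sub>2 :: "(real^'n \<Rightarrow> real^'n) set"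
  assumes "g \<in> vector_fields"
    and "smooth_on UNIV \<omega>"
    and "\<forall>x. blinfun_apply (\<omega> x) (g x) \<noteq> 0"
    and "\<forall>x u v w. wedge_2_1 (ext_deriv \<omega> x) (\<omega> x) u v w = 0"
    and "smooth_on UNIV \<psi>"
    and "\<forall>x. \<mu> x \<noteq> 0"
    and "\<forall>x. (\<psi> has_derivative (\<lambda>v. \<mu> x * blinfun_apply (\<omega> x) v)) (at x)"
    and "N = {x. \<psi> x = 0}"
    and "\<forall>J \<gamma>. maximal_integral_curve g J \<gamma> \<longrightarrow> (\<exists>!p. p \<in> \<gamma> ` J \<inter> N)"
    and "projection_along g N \<pi>"
    and "smooth_on UNIV \<pi>"
    and "M\<^sub>1 \<in> vector_fields // cong_mod g"
    and "M\<^sub>2 \<in> vector_fields // cong_mod g"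
    and "smooth_fun_on_submanifold N \<alpha>"
  shows "class_bracket g \<omega> M\<^sub>1 (class_scale g (\<alpha> \<circ> \<pi>) M\<^sub>2) =
         class_add g (class_scale g (\<alpha> \<circ> \<pi>) (class_bracket g \<omega> M\<^sub>1 M\<^sub>2))
                     (class_scale g (anchor_deriv N \<pi> M\<^sub>1 \<alpha>) M\<^sub>2)"
proof -
  have g: "smooth_on UNIV g" using assms(1) by (simp add: vector_fields_def)
  note \<omega> = assms(2) and \<omega>g = assms(3) and \<pi> = assms(11)
  obtain m\<^sub>1 where m1: "smooth_on UNIV m\<^sub>1" "M\<^sub>1 = field_class g m\<^sub>1"
    using assms(12) by (auto simp: field_class_def vector_fields_def elim: quotientE)
  obtain m\<^sub>2 where m2: "smooth_on UNIV m\<^sub>2" "M\<^sub>2 = field_class g m\<^sub>2"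
    using assms(13) by (auto simp: field_class_def vector_fields_def elim: quotientE)
  let ?f = "\<alpha> \<circ> \<pi>" and ?B = "modified_bracket g \<omega> m\<^sub>1 m\<^sub>2"
  let ?h = "\<lambda>x. frechet_derivative ?f (at x) (m\<^sub>1 x)"
  have range: "range \<pi> \<subseteq> N" using assms(10) by (auto simp: projection_along_def)
  have f: "smooth_on UNIV ?f" by (rule smooth_on_submanifold_compose[OF assms(14) \<pi> range])
  have \<pi>g: "frechet_derivative \<pi> (at x) (g x) = 0" for x
    by (rule projection_along_derivative_zero[OF g assms(10,9) smooth_on_has_derivative[OF \<pi>]]) simp
  have df: "frechet_derivative ?f (at x) v
      = frechet_derivative \<alpha> (at (\<pi> x) within N) (frechet_derivative \<pi> (at x) v)" for x v
    using range smooth_on_submanifold_differentiable[OF assms(14)]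
    by (intro frechet_derivative_compose_within smooth_on_UNIV_differentiable \<pi>) auto
  \<comment> \<open>By \<open>df\<close> and \<open>\<pi>g\<close> the left side is the derivative
    of \<open>\<alpha>\<close> within \<open>N\<close> at the vector 0. That this value is 0 is read
    off from \<open>df\<close> with \<open>v = 0\<close>.\<close>
  have fg: "frechet_derivative ?f (at x) (g x) = 0" for x
    using df[of x "g x"] \<pi>g[of x] linear_0[OF smooth_on_UNIV_linear[OF \<pi>], of x] df[of x 0]
      linear_0[OF smooth_on_UNIV_linear[OF f], of x] by simp
  have anchor: "anchor_deriv N \<pi> M\<^sub>1 \<alpha> = ?h"
  proof (rule ext)
    show "anchor_deriv N \<pi> M\<^sub>1 \<alpha> x = ?h x" for x
      unfolding anchor_deriv_def m1(2) df
      by (subst anchor_field_class[where g = g, OF m1(1) \<pi> \<pi>g]) (rule refl)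
  qed
  have h: "smooth_on UNIV ?h" by (intro smooth_on_frechet_derivative_apply open_UNIV f m1)
  have B: "smooth_on UNIV ?B" by (rule smooth_on_modified_bracket[OF g \<omega> \<omega>g m1(1) m2(1)])
  have fm2: "smooth_on UNIV (\<lambda>x. ?f x *\<^sub>R m\<^sub>2 x)" by (intro smooth_on_scaleR open_UNIV f m2)
  have fB: "smooth_on UNIV (\<lambda>x. ?f x *\<^sub>R ?B x)" by (intro smooth_on_scaleR open_UNIV f B)
  have hm2: "smooth_on UNIV (\<lambda>x. ?h x *\<^sub>R m\<^sub>2 x)" by (intro smooth_on_scaleR open_UNIV h m2)
  have "class_bracket g \<omega> M\<^sub>1 (class_scale g ?f M\<^sub>2)
      = field_class g (modified_bracket g \<omega> m\<^sub>1 (\<lambda>x. ?f x *\<^sub>R m\<^sub>2 x))"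
    unfolding m1(2) m2(2) class_scale_field_class[OF f m2(1)]
    by (rule class_bracket_field_class[OF g \<omega> \<omega>g m1(1) fm2])
  \<comment> \<open>For these representatives the identity holds exactly, not merely modulo
    \<open>g\<close>.\<close>
  also have "\<dots> = field_class g (\<lambda>x. ?f x *\<^sub>R ?B x + ?h x *\<^sub>R m\<^sub>2 x)"
    by (intro arg_cong[where f = "field_class g"] ext modified_bracket_scaleR_right g m1 m2 f fg)
  also have "\<dots> = class_add g (class_scale g ?f (class_bracket g \<omega> M\<^sub>1 M\<^sub>2))
      (class_scale g (anchor_deriv N \<pi> M\<^sub>1 \<alpha>) M\<^sub>2)"
    unfolding anchor unfolding m1(2) m2(2) class_bracket_field_class[OF g \<omega> \<omega>g m1(1) m2(1)]
      class_scale_field_class[OF f B] class_scale_field_class[OF h m2(1)]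
    by (rule class_add_field_class[OF fB hm2, symmetric])
  finally show ?thesis .
qed

end
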